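(* Let $\mathbb{K}$ be an algebraically closed field of characteristic different from $2$, and let $\operatorname{perm}_4$ be the permanent of a generic $4\times 4$ matrix, a quartic form in $16$ variables over $\mathbb{K}$. Then $\mathbf{pr}(\operatorname{perm}_4)\geq 6$, and the tensor rank of $\operatorname{perm}_4$ is at least $6$.
   Context: The product rank $\mathbf{pr}(f)$ of a degree $d$ form $f$ is the smallest number $r$ such that $f=\boldsymbol{\ell}_1+\dots+\boldsymbol{\ell}_r$ where each $\boldsymbol{\ell}_i$ is a product of $d$ linear forms. A generic matrix has independent variables $z_{ij}$ as its entries, and $\operatorname{perm}_4=\sum_{\sigma\in S_4}\prod_{i=1}^4 z_{i\sigma(i)}$. The tensor rank of $\operatorname{perm}_4$ is its rank as a multilinear form in the four rows of the matrix (a tensor in $(\mathbb{K}^4)^{\otimes 4}$), i.e. the smallest number $r$ of summands in an expression of it as a sum of products $\ell_1\ell_2\ell_3\ell_4$ with $\ell_i$ a linear form in the variables of the $i$-th row. *)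

theory Defs
  imports
    "HOL-Library.Poly_Mapping"
    "HOL-Library.Numeral_Type"
    "HOL-Computational_Algebra.Polynomial"
    "HOL-Combinatorics.Permutations"
begin

(* Polynomials as the monoid algebra over exponent vectors: the keys are monomials,
   the values are coefficients. *)
type_synonym ('v, 'a) mpoly = "('v \<Rightarrow>\<^sub>0 nat) \<Rightarrow>\<^sub>0 'a"

definition Const :: "'a \<Rightarrow> ('v, 'a::comm_ring_1) mpoly"
  where "Const c = Poly_Mapping.single 0 c"

definition Var :: "'v \<Rightarrow> ('v, 'a::comm_ring_1) mpoly"
  where "Var v = Poly_Mapping.single (Poly_Mapping.single v 1) 1"

definition linear_form :: "('v::finite, 'a::comm_ring_1) mpoly \<Rightarrow> bool"
  where "linear_form l \<longleftrightarrow> (\<exists>c. l = (\<Sum>v\<in>UNIV. Const (c v) * Var v))"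

(* The degree d is passed explicitly; a nonzero form determines it.  When f is not a sum of
   products of d linear forms (f not homogeneous of degree d, or d = 0 and f not a natural multiple
   of 1), the value is unspecified. *)
definition product_rank :: "nat \<Rightarrow> ('v::finite, 'a::comm_ring_1) mpoly \<Rightarrow> nat"
  where "product_rank d f =
    (LEAST r. \<exists>l :: nat \<Rightarrow> nat \<Rightarrow> ('v, 'a) mpoly.
       (\<forall>k<r. \<forall>i<d. linear_form (l k i)) \<and> f = (\<Sum>k<r. \<Prod>i<d. l k i))"

definition row_linear_form ::
    "'m \<Rightarrow> ('m::finite \<times> 'n::finite, 'a::comm_ring_1) mpoly \<Rightarrow> bool"
  where "row_linear_form i l \<longleftrightarrow> (\<exists>c. l = (\<Sum>j\<in>UNIV. Const (c j) * Var (i, j)))"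

(* Rank of a form that is multilinear in the rows of a matrix of variables,
   one factor for each row; unspecified if f is not such a form. *)
definition tensor_rank :: "('m::finite \<times> 'n::finite, 'a::comm_ring_1) mpoly \<Rightarrow> nat"
  where "tensor_rank f =
    (LEAST r. \<exists>l :: nat \<Rightarrow> 'm \<Rightarrow> ('m \<times> 'n, 'a) mpoly.
       (\<forall>k<r. \<forall>i. row_linear_form i (l k i)) \<and> f = (\<Sum>k<r. \<Prod>i\<in>UNIV. l k i))"

definition permanent :: "('n::finite \<Rightarrow> 'n \<Rightarrow> 'r::comm_ring_1) \<Rightarrow> 'r"
  where "permanent A = (\<Sum>\<sigma> | \<sigma> permutes UNIV. \<Prod>i\<in>UNIV. A i (\<sigma> i))"

definition generic_matrix :: "'m \<Rightarrow> 'n \<Rightarrow> ('m \<times> 'n, 'a::comm_ring_1) mpoly"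
  where "generic_matrix i j = Var (i, j)"

definition perm4 :: "(4 \<times> 4, 'a::comm_ring_1) mpoly"
  where "perm4 = permanent generic_matrix"

(* The two lemmas below show that the minima defining the ranks of perm4 are taken over
   nonempty sets. *)
lemma perm4_tensor_decomposition:
  "\<exists>r (l :: nat \<Rightarrow> 4 \<Rightarrow> (4 \<times> 4, 'a::comm_ring_1) mpoly).
     (\<forall>k<r. \<forall>i. row_linear_form i (l k i)) \<and> perm4 = (\<Sum>k<r. \<Prod>i\<in>UNIV. l k i)"
proof -
  let ?P = "{\<sigma> :: 4 \<Rightarrow> 4. \<sigma> permutes UNIV}"
  have "finite ?P" by (simp add: finite_permutations)
  then obtain h where h: "bij_betw h {..<card ?P} ?P"
    using ex_bij_betw_nat_finite[of ?P] by (auto simp: atLeast0LessThan)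
  have row: "row_linear_form i (Var (i, j) :: (4 \<times> 4, 'a) mpoly)" for i j
  proof -
    have "(\<Sum>j'\<in>UNIV. Const (if j' = j then 1 else 0) * Var (i, j')) =
          (\<Sum>j'\<in>UNIV. if j' = j then Var (i, j') else (0 :: (4 \<times> 4, 'a) mpoly))"
      by (intro sum.cong) (auto simp: Const_def)
    also have "\<dots> = Var (i, j)" by simp
    finally have "Var (i, j) = (\<Sum>j'\<in>UNIV. Const (if j' = j then 1 else 0) * (Var (i, j') :: (4 \<times> 4, 'a) mpoly))"
      by (rule sym)
    then show ?thesis
      unfolding row_linear_form_def by (rule exI[where x = "\<lambda>j'. if j' = j then 1 else 0"])
  qed
  have "(perm4 :: (4 \<times> 4, 'a) mpoly) = (\<Sum>k<card ?P. \<Prod>i\<in>UNIV. Var (i, h k i))"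
    unfolding perm4_def permanent_def generic_matrix_def
    using sum.reindex_bij_betw[OF h, of "\<lambda>\<sigma>. \<Prod>i\<in>UNIV. Var (i, \<sigma> i) :: (4 \<times> 4, 'a) mpoly"]
    by simp
  with row show ?thesis
    by (intro exI[of _ "card ?P"] exI[of _ "\<lambda>k i. Var (i, h k i)"]) simp
qed

lemma perm4_product_decomposition:
  "\<exists>r (l :: nat \<Rightarrow> nat \<Rightarrow> (4 \<times> 4, 'a::comm_ring_1) mpoly).
     (\<forall>k<r. \<forall>i<4. linear_form (l k i)) \<and> perm4 = (\<Sum>k<r. \<Prod>i<4. l k i)"
proof -
  have lin: "linear_form l" if "row_linear_form i l" for i :: 4 and l :: "(4 \<times> 4, 'a) mpoly"
  proof -
    obtain c where c: "l = (\<Sum>j\<in>UNIV. Const (c j) * Var (i, j))"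
      using \<open>row_linear_form i l\<close> unfolding row_linear_form_def by blast
    have "(\<Sum>v\<in>UNIV. Const (if fst v = i then c (snd v) else 0) * Var v) =
          (\<Sum>v\<in>{i} \<times> UNIV. Const (c (snd v)) * Var v :: (4 \<times> 4, 'a) mpoly)"
      by (intro sum.mono_neutral_cong_right) (auto simp: Const_def)
    also have "\<dots> = (\<Sum>i'\<in>{i}. \<Sum>j\<in>UNIV. Const (c j) * Var (i', j))"
      by (subst sum.cartesian_product) (simp add: case_prod_unfold)
    also have "\<dots> = l" by (simp add: c)
    finally show ?thesis
      unfolding linear_form_def by (intro exI) (rule sym)
  qed
  obtain h :: "nat \<Rightarrow> 4" where h: "bij_betw h {..<4} UNIV"
    using ex_bij_betw_nat_finite[of "UNIV :: 4 set"] by (auto simp: atLeast0LessThan)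
  obtain r and l :: "nat \<Rightarrow> 4 \<Rightarrow> (4 \<times> 4, 'a) mpoly"
    where l: "\<forall>k<r. \<forall>i. row_linear_form i (l k i)" and eq: "perm4 = (\<Sum>k<r. \<Prod>i\<in>UNIV. l k i)"
    using perm4_tensor_decomposition by blast
  have "perm4 = (\<Sum>k<r. \<Prod>i<4. l k (h i))"
    unfolding eq by (simp add: prod.reindex_bij_betw[OF h])
  with l lin show ?thesis
    by (intro exI[of _ r] exI[of _ "\<lambda>k i. l k (h i)"]) blast
qed

end

(* The mixed partial derivatives D_a D_b D_c D_d of a quartic form f, for pairs (a, b) and (c, d) of
   variables, form a matrix that depends linearly on f (the middle catalecticant of f).  For a
   product l1 l2 l3 l4 of linear forms its rank is at most 6, since every second derivative lies in
   the span of the six products li lj.  For the permanent, the second derivatives are the 36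
   permanents of 2 x 2 submatrices, which are linearly independent: selecting for every 2 x 2
   submatrix its diagonal as (a, b), one obtains a permutation matrix of size 36.  Hence 36 <= 6 r
   for every expression of perm4 as a sum of r products.  A tensor decomposition is in particular a
   decomposition into products of linear forms. *)
theory Submission
  imports Defs "HOL-Library.Function_Algebras"
begin

section \<open>Evaluation of polynomials as a ring homomorphism\<close>

definition insertion :: "('v::finite \<Rightarrow> 'a) \<Rightarrow> ('v, 'a::comm_ring_1) mpoly \<Rightarrow> 'a"
  where "insertion x p = (\<Sum>m\<in>Poly_Mapping.keys p. Poly_Mapping.lookup p m * (\<Prod>v\<in>UNIV. x v ^ Poly_Mapping.lookup m v))"

lemma insertion_superset:
  assumes "finite M" "Poly_Mapping.keys p \<subseteq> M"
  shows "insertion x p = (\<Sum>m\<in>M. Poly_Mapping.lookup p m * (\<Prod>v\<in>UNIV. x v ^ Poly_Mapping.lookup m v))"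
  unfolding insertion_def using assms
  by (intro sum.mono_neutral_left) (auto simp: in_keys_iff)

lemma insertion_single:
  "insertion x (Poly_Mapping.single m c) = c * (\<Prod>v\<in>UNIV. x v ^ Poly_Mapping.lookup m v)"
  by (subst insertion_superset[of "{m}"]) auto

lemma insertion_zero [simp]: "insertion x 0 = 0"
  by (simp add: insertion_def)

lemma insertion_add: "insertion x (p + q) = insertion x p + insertion x q"
proof -
  let ?M = "Poly_Mapping.keys p \<union> Poly_Mapping.keys q"
  have "Poly_Mapping.keys (p + q) \<subseteq> ?M" by (rule Poly_Mapping.keys_add)
  then show ?thesis
    by (simp add: insertion_superset[of ?M] lookup_add distrib_right sum.distrib)
qed

lemma insertion_sum: "insertion x (\<Sum>i\<in>I. p i) = (\<Sum>i\<in>I. insertion x (p i))"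
  by (induction I rule: infinite_finite_induct) (auto simp: insertion_add)

lemma poly_mapping_eq_sum_single:
  "p = (\<Sum>m\<in>Poly_Mapping.keys p. Poly_Mapping.single m (Poly_Mapping.lookup p m))"
  by (rule poly_mapping_eqI) (auto simp: lookup_sum lookup_single when_def in_keys_iff)

lemma insertion_mult:
  fixes x :: "'v::finite \<Rightarrow> 'a::comm_ring_1"
  shows "insertion x (p * q) = insertion x p * insertion x q"
proof -
  have *: "insertion x (Poly_Mapping.single m a * Poly_Mapping.single n b) =
      insertion x (Poly_Mapping.single m a) * insertion x (Poly_Mapping.single n b)" for m n a b
    by (simp add: mult_single insertion_single lookup_add power_add prod.distrib)
  \<comment> \<open>Both sides are biadditive, so the case of monomials suffices. Naming the
    expansion keeps it folded while the product is distributed.\<close>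
  define expand where
    "expand r = (\<Sum>m\<in>Poly_Mapping.keys r. Poly_Mapping.single m (Poly_Mapping.lookup r m))"
    for r :: "('v, 'a) mpoly"
  have "insertion x (expand p * expand q) = insertion x (expand p) * insertion x (expand q)"
    by (simp only: expand_def sum_product insertion_sum *)
  then show ?thesis by (simp add: expand_def flip: poly_mapping_eq_sum_single)
qed

lemma insertion_one [simp]: "insertion x 1 = 1"
  using insertion_single[of x 0 1] by simp

lemma insertion_prod: "insertion x (\<Prod>i\<in>I. p i) = (\<Prod>i\<in>I. insertion x (p i))"
  by (induction I rule: infinite_finite_induct) (auto simp: insertion_mult)

lemma insertion_Const [simp]: "insertion x (Const c) = c"
  by (simp add: Const_def insertion_single)

lemma insertion_Var [simp]: "insertion x (Var v) = x v"
proof -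
  have "(\<Prod>w\<in>UNIV. x w ^ Poly_Mapping.lookup (Poly_Mapping.single v 1) w) = (\<Prod>w\<in>UNIV. if w = v then x w else 1)"
    by (intro prod.cong) (auto simp: lookup_single)
  then show ?thesis by (simp add: Var_def insertion_single)
qed

section \<open>Ryser's formula\<close>

text \<open>Taking complements gives the binomial expansion of
  \<open>(-1 + 1) ^ card (- T)\<close>.\<close>

lemma alternating_sum_supersets:
  fixes T :: "'n::finite set"
  shows "(\<Sum>S | T \<subseteq> S. (- 1) ^ card (- S)) = (of_bool (T = UNIV) :: 'a::comm_ring_1)"
proof -
  have "bij_betw uminus {S. T \<subseteq> S} (Pow (- T))"
    by (rule bij_betw_byWitness[of _ uminus]) auto
  then have "(\<Sum>S | T \<subseteq> S. (- 1) ^ card (- S)) = (\<Sum>S\<in>Pow (- T). (- 1 :: 'a) ^ card S)"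
    by (rule sum.reindex_bij_betw)
  also have "\<dots> = (\<Prod>i\<in>- T. (- 1 :: 'a) + 1)"
    by (subst prod_add) auto
  also have "\<dots> = of_bool (T = UNIV)"
    by (auto simp: power_0_left)
  finally show ?thesis .
qed

lemma permutes_UNIV_iff_bij: "\<sigma> permutes UNIV \<longleftrightarrow> bij \<sigma>"
  by (metis bij_imp_permutes permutes_bij UNIV_I)

text \<open>Expanding each product gives terms indexed by maps \<open>g\<close> into
  \<open>S\<close>. Summed over all \<open>S\<close> containing \<open>range g\<close>, the signs
  cancel unless \<open>g\<close> is surjective, hence a permutation.\<close>

lemma permanent_Ryser:
  fixes A :: "'n::finite \<Rightarrow> 'n \<Rightarrow> 'a::comm_ring_1"
  shows "permanent A = (\<Sum>S\<in>UNIV. (- 1) ^ card (- S) * (\<Prod>i\<in>UNIV. \<Sum>j\<in>S. A i j))"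
proof -
  have "(\<Sum>S\<in>UNIV. (- 1) ^ card (- S) * (\<Prod>i\<in>UNIV. \<Sum>j\<in>S. A i j)) =
      (\<Sum>S\<in>UNIV. \<Sum>g | range g \<subseteq> S. (- 1) ^ card (- S) * (\<Prod>i\<in>UNIV. A i (g i)))"
  proof (intro sum.cong refl)
    fix S :: "'n set"
    have *: "PiE UNIV (\<lambda>_. S) = {g. range g \<subseteq> S}" by (auto simp: PiE_def)
    show "(- 1) ^ card (- S) * (\<Prod>i\<in>UNIV. \<Sum>j\<in>S. A i j) =
        (\<Sum>g | range g \<subseteq> S. (- 1) ^ card (- S) * (\<Prod>i\<in>UNIV. A i (g i)))"
      by (subst prod_sum_PiE) (simp_all add: * sum_distrib_left)
  qed
  also have "\<dots> = (\<Sum>g\<in>UNIV. \<Sum>S | range g \<subseteq> S. (- 1) ^ card (- S) * (\<Prod>i\<in>UNIV. A i (g i)))"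
    using sum.swap_restrict[of UNIV UNIV "\<lambda>S g. (- 1) ^ card (- S) * (\<Prod>i\<in>UNIV. A i (g i))" "\<lambda>S g. range g \<subseteq> S"]
    by simp
  also have "\<dots> = (\<Sum>g\<in>UNIV. of_bool (range g = UNIV) * (\<Prod>i\<in>UNIV. A i (g i)))"
    by (simp add: alternating_sum_supersets flip: sum_distrib_right)
  also have "\<dots> = (\<Sum>g | range g = UNIV. \<Prod>i\<in>UNIV. A i (g i))"
    by (intro sum.mono_neutral_cong_right) auto
  also have "{g :: 'n \<Rightarrow> 'n. range g = UNIV} = {g. g permutes UNIV}"
    using finite_UNIV_surj_inj[OF finite] by (auto simp: permutes_UNIV_iff_bij bij_def)
  finally show ?thesis by (simp add: permanent_def)
qed

section \<open>Polarization of products of linear forms and of the permanent\<close>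

text \<open>
  For a form of degree \<open>CARD('n)\<close> this is the iterated derivative along the variables \<open>v s\<close>, computed
  from values alone; on a product of linear forms it becomes Ryser's formula for a permanent.
\<close>

definition polarization :: "('n::finite \<Rightarrow> 'v::finite) \<Rightarrow> ('v, 'a::comm_ring_1) mpoly \<Rightarrow> 'a"
  where "polarization v p =
    (\<Sum>S\<in>UNIV. (- 1) ^ card (- S) * insertion (\<lambda>w. \<Sum>s\<in>S. of_bool (w = v s)) p)"

lemma polarization_sum: "polarization v (\<Sum>i\<in>I. p i) = (\<Sum>i\<in>I. polarization v (p i))"
  unfolding polarization_def insertion_sum sum_distrib_left by (rule sum.swap)

lemma polarization_prod_linear_forms:
  fixes v :: "'n::finite \<Rightarrow> 'v::finite" and c :: "'n \<Rightarrow> 'v \<Rightarrow> 'a::comm_ring_1"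
  shows "polarization v (\<Prod>i\<in>UNIV. \<Sum>w\<in>UNIV. Const (c i w) * Var w) = permanent (\<lambda>i s. c i (v s))"
proof -
  have "insertion (\<lambda>w. \<Sum>s\<in>S. of_bool (w = v s)) (\<Sum>w\<in>UNIV. Const (c i w) * Var w) = (\<Sum>s\<in>S. c i (v s))"
    (is "?lhs = _") for S i
  proof -
    have "?lhs = (\<Sum>w\<in>UNIV. \<Sum>s\<in>S. c i w * of_bool (w = v s))"
      by (simp only: insertion_sum insertion_mult sum_distrib_left insertion_Const insertion_Var)
    also have "\<dots> = (\<Sum>s\<in>S. \<Sum>w\<in>UNIV. if w = v s then c i w else 0)"
      by (subst sum.swap) (auto intro!: sum.cong)
    finally show ?thesis by simp
  qed
  then show ?thesis
    by (simp add: polarization_def insertion_prod permanent_Ryser)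
qed

lemma Var_eq_sum: "Var w = (\<Sum>u\<in>UNIV. Const (of_bool (u = w)) * Var u :: ('v::finite, 'a::comm_ring_1) mpoly)"
proof -
  have "(\<Sum>u\<in>UNIV. Const (of_bool (u = w)) * Var u :: ('v, 'a) mpoly) = (\<Sum>u\<in>UNIV. if u = w then Var u else 0)"
    by (intro sum.cong) (auto simp: Const_def)
  then show ?thesis by simp
qed

lemma prod_of_bool: "finite A \<Longrightarrow> (\<Prod>i\<in>A. of_bool (P i)) = (of_bool (\<forall>i\<in>A. P i) :: 'a::comm_semiring_1)"
  by (induction A rule: finite_induct) auto

text \<open>Each \<sigma> contributes a product of variables, hence the permanent of a 0-1 matrix.
  Expanding these counts the pairs (\<sigma>, \<pi>) for which \<open>v \<circ> \<pi>\<close> runs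
  through the graph of \<sigma>.\<close>

lemma polarization_permanent:
  fixes v :: "'n::finite \<Rightarrow> 'n \<times> 'n"
  shows "polarization v (permanent generic_matrix :: ('n \<times> 'n, 'a::comm_ring_1) mpoly) =
    of_bool (bij (fst \<circ> v) \<and> bij (snd \<circ> v))"
proof -
  let ?P = "{\<sigma> :: 'n \<Rightarrow> 'n. \<sigma> permutes UNIV}"
  let ?r = "fst \<circ> v" and ?k = "snd \<circ> v"
  have fin: "finite ?P" by simp
  have "polarization v (permanent generic_matrix :: ('n \<times> 'n, 'a) mpoly) =
      (\<Sum>\<sigma>\<in>?P. permanent (\<lambda>i s. of_bool (v s = (i, \<sigma> i))))"
    unfolding permanent_def[of generic_matrix] generic_matrix_def polarization_sum
    by (subst Var_eq_sum) (simp add: polarization_prod_linear_forms)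
  also have "\<dots> = (\<Sum>\<sigma>\<in>?P. \<Sum>\<pi>\<in>?P. of_bool (\<forall>i. v (\<pi> i) = (i, \<sigma> i)))"
    by (simp add: permanent_def prod_of_bool)
  also have "\<dots> = (\<Sum>(\<sigma>, \<pi>)\<in>?P \<times> ?P. of_bool (\<forall>i. v (\<pi> i) = (i, \<sigma> i)))"
    by (rule sum.cartesian_product)
  also have "\<dots> = of_nat (card {(\<sigma>, \<pi>) \<in> ?P \<times> ?P. \<forall>i. v (\<pi> i) = (i, \<sigma> i)})"
    using fin by (simp add: case_prod_unfold Int_def mem_Times_iff conj_assoc)
  \<comment> \<open>The rows force \<pi> to invert \<open>?r\<close>, and the columns then determine
    \<sigma>: at most one pair is counted.\<close>
  also have "{(\<sigma>, \<pi>) \<in> ?P \<times> ?P. \<forall>i. v (\<pi> i) = (i, \<sigma> i)} =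
      (if bij ?r \<and> bij ?k then {(?k \<circ> inv ?r, inv ?r)} else {})" (is "?L = ?R")
  proof (rule set_eqI, clarify)
    fix \<sigma> \<pi> :: "'n \<Rightarrow> 'n"
    have "(\<sigma>, \<pi>) \<in> ?L \<longleftrightarrow> bij \<sigma> \<and> bij \<pi> \<and> ?r \<circ> \<pi> = id \<and> ?k \<circ> \<pi> = \<sigma>"
      by (auto simp: permutes_UNIV_iff_bij fun_eq_iff prod_eq_iff)
    also have "\<dots> \<longleftrightarrow> bij ?r \<and> bij ?k \<and> \<pi> = inv ?r \<and> \<sigma> = ?k \<circ> inv ?r"
    proof (intro iffI; elim conjE)
      assume *: "bij \<sigma>" "bij \<pi>" "?r \<circ> \<pi> = id" "?k \<circ> \<pi> = \<sigma>"
      have r: "?r = inv \<pi>"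
        by (metis *(2,3) bij_is_surj comp_assoc comp_id id_comp surj_iff)
      have "?k = \<sigma> \<circ> inv \<pi>"
        using *(2,4) by (metis bij_is_surj comp_assoc comp_id surj_iff)
      with * r show "bij ?r \<and> bij ?k \<and> \<pi> = inv ?r \<and> \<sigma> = ?k \<circ> inv ?r"
        by (metis bij_betw_trans bij_imp_bij_inv inv_inv_eq)
    next
      assume *: "bij ?r" "bij ?k" "\<pi> = inv ?r" "\<sigma> = ?k \<circ> inv ?r"
      then show "bij \<sigma> \<and> bij \<pi> \<and> ?r \<circ> \<pi> = id \<and> ?k \<circ> \<pi> = \<sigma>"
        by (metis bij_betw_trans bij_imp_bij_inv bij_is_surj surj_iff)
    qed
    also have "\<dots> \<longleftrightarrow> (\<sigma>, \<pi>) \<in> ?R" by auto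
    finally show "(\<sigma>, \<pi>) \<in> ?L \<longleftrightarrow> (\<sigma>, \<pi>) \<in> ?R" .
  qed
  finally show ?thesis by simp
qed

section \<open>Permanents of size four\<close>

lemma exhaust_4: "x = 0 \<or> x = 1 \<or> x = 2 \<or> x = (3::4)"
proof (induct x)
  case (of_int z)
  then have "z = 0 \<or> z = 1 \<or> z = 2 \<or> z = 3" by fastforce
  then show ?case by auto
qed

lemma UNIV_4: "(UNIV :: 4 set) = {0, 1, 2, 3}"
  using exhaust_4 by auto

text \<open>Laplace expansion along the first two columns.\<close>

lemma permanent_4:
  fixes A :: "4 \<Rightarrow> 4 \<Rightarrow> 'a::comm_ring_1"
  defines "G \<equiv> \<lambda>i k s t. A i s * A k t + A k s * A i t"
  shows "permanent A = G 0 1 0 1 * G 2 3 2 3 + G 0 2 0 1 * G 1 3 2 3 + G 0 3 0 1 * G 1 2 2 3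
    + G 1 2 0 1 * G 0 3 2 3 + G 1 3 0 1 * G 0 2 2 3 + G 2 3 0 1 * G 0 1 2 3"
proof -
  have f: "finite {1::4, 2, 3}" "0 \<notin> {1::4, 2, 3}" "finite {2::4, 3}" "1 \<notin> {2::4, 3}"
    "finite {3::4}" "2 \<notin> {3::4}"
    by simp_all
  show ?thesis
    unfolding permanent_def UNIV_4 G_def
    \<comment> \<open>The images of 0, 1 and 2 are split off in turn, down to permutations of
      \<open>{3}\<close>.\<close>
    unfolding sum_over_permutations_insert[OF f(1,2)]
    unfolding sum_over_permutations_insert[OF f(3,4)]
    unfolding sum_over_permutations_insert[OF f(5,6)]
    unfolding permutes_sing
    by (simp add: transpose_def algebra_simps)
qed

section \<open>A dimension bound from a dual system\<close>

text \<open>The values at the points \<open>\<tau> x'\<close> form an identity matrix, so the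
  functions \<open>F x\<close> are linearly independent.\<close>

lemma card_le_of_span:
  fixes F :: "'b \<Rightarrow> 'c \<Rightarrow> 'a::field"
  defines "scale \<equiv> \<lambda>(c::'a) (f::'c \<Rightarrow> 'a) x. c * f x"
  assumes "finite X" "finite T"
    and span: "\<And>x. x \<in> X \<Longrightarrow> F x \<in> module.span scale T"
    and dual: "\<And>x x'. x \<in> X \<Longrightarrow> x' \<in> X \<Longrightarrow> F x (\<tau> x') = of_bool (x = x')"
  shows "card X \<le> card T"
proof -
  interpret vector_space scale
    by unfold_locales (auto simp: scale_def algebra_simps)
  have inj: "inj_on F X"
    by (rule inj_onI) (metis dual of_bool_eq_iff)
  have "independent (F ` X)"
  proof (rule independent_if_scalars_zero)
    fix f g assume sum: "(\<Sum>g\<in>F ` X. scale (f g) g) = 0" and "g \<in> F ` X"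
    then obtain x where x: "x \<in> X" "g = F x" by blast
    have *: "(\<Sum>y\<in>Y. h y) z = (\<Sum>y\<in>Y. h y z)" for Y and h :: "'b \<Rightarrow> 'c \<Rightarrow> 'a" and z
      by (induction Y rule: infinite_finite_induct) auto
    \<comment> \<open>Evaluating the relation at \<open>\<tau> x\<close> isolates the coefficient of
      \<open>F x\<close>.\<close>
    have "0 = (\<Sum>g\<in>F ` X. scale (f g) g) (\<tau> x)" by (simp add: sum)
    also have "\<dots> = (\<Sum>y\<in>X. f (F y) * F y (\<tau> x))"
      by (simp add: sum.reindex[OF inj] * scale_def)
    also have "\<dots> = (\<Sum>y\<in>X. if y = x then f (F x) else 0)"
      by (intro sum.cong) (auto simp: dual x)
    also have "\<dots> = f g" using x \<open>finite X\<close> by simp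
    finally show "f g = 0" by simp
  qed (use \<open>finite X\<close> in simp)
  then have "card (F ` X) \<le> card T"
    using independent_span_bound[OF \<open>finite T\<close>] span by blast
  then show ?thesis by (simp add: card_image inj)
qed

section \<open>Index pairs and their complements\<close>

text \<open>Increasing pairs encode the 2-element subsets of the row, column or factor
  indices.\<close>

definition pairs4 :: "(4 \<times> 4) set"
  where "pairs4 = {(0,1), (0,2), (0,3), (1,2), (1,3), (2,3)}"

text \<open>The value on arguments outside \<open>pairs4\<close> is irrelevant.\<close>

definition compl4 :: "4 \<times> 4 \<Rightarrow> 4 \<times> 4"
  where "compl4 p = (if p = (0,1) then (2,3) else if p = (0,2) then (1,3) else if p = (0,3) then (1,2)
    else if p = (1,2) then (0,3) else if p = (1,3) then (0,2) else (0,1))"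

definition join4 :: "'b \<times> 'b \<Rightarrow> 'b \<times> 'b \<Rightarrow> 4 \<Rightarrow> 'b"
  where "join4 p q s = (if s = 0 then fst p else if s = 1 then snd p else if s = 2 then fst q else snd q)"

text \<open>A pair \<open>p\<close> and the complement of \<open>q\<close> exhaust the four indices
  only if they are disjoint. This makes the selected catalecticant minor an identity matrix.\<close>

lemma bij_join4_compl4:
  assumes "p \<in> pairs4" "q \<in> pairs4"
  shows "bij (join4 p (compl4 q)) \<longleftrightarrow> p = q"
proof -
  have bij: "bij f \<longleftrightarrow> distinct [f 0, f 1, f 2, f 3]" for f :: "4 \<Rightarrow> 4"
  proof -
    have "bij f \<longleftrightarrow> inj f"
      using finite_UNIV_inj_surj[OF finite, of f] by (auto simp: bij_def)
    also have "\<dots> \<longleftrightarrow> inj_on f {0, 1, 2, 3}"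
      by (simp only: UNIV_4)
    also have "\<dots> \<longleftrightarrow> distinct (map f [0, 1, 2, 3])"
      by (simp only: distinct_map) simp
    finally show ?thesis by simp
  qed
  show ?thesis
    using assms unfolding bij pairs4_def
    by (elim insertE emptyE) (simp_all add: compl4_def join4_def)
qed

section \<open>The catalecticant bound\<close>

lemma perm4_product_bound:
  fixes l :: "nat \<Rightarrow> 4 \<Rightarrow> (4 \<times> 4, 'a::field) mpoly"
  assumes lin: "\<And>k i. k < r \<Longrightarrow> linear_form (l k i)"
    and perm4: "perm4 = (\<Sum>k<r. \<Prod>i\<in>UNIV. l k i)"
  shows "6 \<le> r"
proof -
  define scale where "scale = (\<lambda>(c::'a) (f::(4 \<times> 4) \<times> (4 \<times> 4) \<Rightarrow> 'a) x. c * f x)"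
  interpret vector_space scale
    by unfold_locales (auto simp: scale_def algebra_simps)
  define c where "c k i = (SOME c. l k i = (\<Sum>w\<in>UNIV. Const (c w) * Var w))" for k i
  have c: "l k i = (\<Sum>w\<in>UNIV. Const (c k i w) * Var w)" if "k < r" for k i
    using someI_ex[OF lin[OF that, of i, unfolded linear_form_def]] by (simp only: c_def)
  \<comment> \<open>\<open>(p, p')\<close> in \<open>pairs4 \<times> pairs4\<close> stands for the 2 x 2 submatrix with rows \<open>p\<close> and columns \<open>p'\<close>;
    \<open>v x y\<close> lists the diagonal entries of the submatrices \<open>x\<close> and \<open>y\<close>.\<close>
  define v where "v x y s = (join4 (fst x) (fst y) s, join4 (snd x) (snd y) s)"
    for x y :: "(4 \<times> 4) \<times> (4 \<times> 4)" and s
  \<comment> \<open>\<open>F x\<close> is a row of the catalecticant of \<open>perm4\<close>, with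
    columns indexed by \<open>y\<close>.\<close>
  define F where "F x y = polarization (v x y) (perm4 :: (4 \<times> 4, 'a) mpoly)" for x y
  \<comment> \<open>\<open>G k p y\<close> is the second derivative, along the diagonal entries of
    \<open>y\<close>, of the product of the two factors of summand \<open>k\<close> selected by
    \<open>p\<close>.\<close>
  define G where "G k p y = c k (fst p) (fst (fst y), fst (snd y)) * c k (snd p) (snd (fst y), snd (snd y))
    + c k (snd p) (fst (fst y), fst (snd y)) * c k (fst p) (snd (fst y), snd (snd y))" for k p y
  define T where "T = (\<lambda>(k, p). G k p) ` ({..<r} \<times> pairs4)"
  define X where "X = pairs4 \<times> pairs4"
  have card_pairs: "card pairs4 = 6" "finite pairs4" by (simp_all add: pairs4_def)
  \<comment> \<open>Laplace expansion separates \<open>x\<close> from \<open>y\<close>: for fixed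
    \<open>x\<close>, the values \<open>G k p x\<close> are scalars multiplying the functions
    \<open>G k q\<close>.\<close>
  have F: "F x = (\<Sum>k<r. scale (G k (0,1) x) (G k (2,3)) + scale (G k (0,2) x) (G k (1,3))
      + scale (G k (0,3) x) (G k (1,2)) + scale (G k (1,2) x) (G k (0,3))
      + scale (G k (1,3) x) (G k (0,2)) + scale (G k (2,3) x) (G k (0,1)))" for x
  proof
    fix y
    have sum_apply: "(\<Sum>k\<in>K. h k) z = (\<Sum>k\<in>K. h k z)"
      for K :: "nat set" and h :: "nat \<Rightarrow> (4 \<times> 4) \<times> (4 \<times> 4) \<Rightarrow> 'a" and z
      by (induction K rule: infinite_finite_induct) auto
    have "F x y = (\<Sum>k<r. permanent (\<lambda>i s. c k i (v x y s)))"
      by (simp add: F_def perm4 polarization_sum c polarization_prod_linear_forms)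
    also have "\<dots> = (\<Sum>k<r. G k (0,1) x * G k (2,3) y + G k (0,2) x * G k (1,3) y
        + G k (0,3) x * G k (1,2) y + G k (1,2) x * G k (0,3) y
        + G k (1,3) x * G k (0,2) y + G k (2,3) x * G k (0,1) y)"
      by (intro sum.cong refl) (simp add: permanent_4 G_def v_def join4_def)
    finally show "F x y = (\<Sum>k<r. scale (G k (0,1) x) (G k (2,3)) + scale (G k (0,2) x) (G k (1,3))
      + scale (G k (0,3) x) (G k (1,2)) + scale (G k (1,2) x) (G k (0,3))
      + scale (G k (1,3) x) (G k (0,2)) + scale (G k (2,3) x) (G k (0,1))) y"
      by (simp add: sum_apply scale_def)
  qed
  have G: "G k p \<in> span T" if "k < r" "p \<in> pairs4" for k p
    using that by (intro span_base) (auto simp: T_def)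
  have "card X \<le> card T"
  \<comment> \<open>The dual point of a submatrix is the complementary submatrix: the two diagonals
    together then meet every row and column once.\<close>
  proof (rule card_le_of_span[where F = F and \<tau> = "\<lambda>(p, q). (compl4 p, compl4 q)", folded scale_def])
    show "finite X" "finite T" using card_pairs by (auto simp: X_def T_def)
  next
    fix x assume "x \<in> X"
    show "F x \<in> span T"
      unfolding F by (intro span_sum span_add span_scale G) (auto simp: pairs4_def)
  next
    fix x x' assume x: "x \<in> X" "x' \<in> X"
    have comp: "fst \<circ> v x y = join4 (fst x) (fst y)" "snd \<circ> v x y = join4 (snd x) (snd y)" for y
      by (auto simp: v_def)
    show "F x (case x' of (p, q) \<Rightarrow> (compl4 p, compl4 q)) = of_bool (x = x')"
      using x by (auto simp: F_def perm4_def polarization_permanent comp X_def bij_join4_compl4)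
  qed
  moreover have "card T \<le> card ({..<r} \<times> pairs4)"
    unfolding T_def using card_pairs by (intro card_image_le) auto
  ultimately show ?thesis
    by (simp add: X_def card_cartesian_product card_pairs)
qed

section \<open>Transfer to the two ranks\<close>

lemma linear_form_of_row:
  assumes "row_linear_form i l"
  shows "linear_form l"
proof -
  obtain c where c: "l = (\<Sum>j\<in>UNIV. Const (c j) * Var (i, j))"
    using assms unfolding row_linear_form_def by blast
  have "(\<Sum>v\<in>UNIV. Const (if fst v = i then c (snd v) else 0) * Var v) =
      (\<Sum>v\<in>{i} \<times> UNIV. Const (c (snd v)) * Var v)"
    by (intro sum.mono_neutral_cong_right) (auto simp: Const_def)
  also have "\<dots> = (\<Sum>i'\<in>{i}. \<Sum>j\<in>UNIV. Const (c j) * Var (i', j))"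
    by (subst sum.cartesian_product) (simp add: case_prod_unfold)
  also have "\<dots> = l" by (simp add: c)
  finally show ?thesis
    unfolding linear_form_def by (intro exI) (rule sym)
qed

theorem mainTheorem5:
  assumes "CHAR('a::alg_closed_field) \<noteq> 2"
  shows "product_rank 4 (perm4 :: (4 \<times> 4, 'a) mpoly) \<ge> 6
       \<and> tensor_rank (perm4 :: (4 \<times> 4, 'a) mpoly) \<ge> 6"
proof
  obtain l :: "nat \<Rightarrow> nat \<Rightarrow> (4 \<times> 4, 'a) mpoly"
    where l: "\<forall>k<product_rank 4 (perm4 :: (4 \<times> 4, 'a) mpoly). \<forall>i<4. linear_form (l k i)"
      "perm4 = (\<Sum>k<product_rank 4 (perm4 :: (4 \<times> 4, 'a) mpoly). \<Prod>i<4. l k i)"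
    \<comment> \<open>Since a decomposition exists, the minimum is attained.\<close>
    using LeastI_ex[OF perm4_product_decomposition[where 'a = 'a]] unfolding product_rank_def by blast
  \<comment> \<open>\<open>h\<close> renumbers the factors by the type \<open>4\<close>.\<close>
  obtain h :: "4 \<Rightarrow> nat" where h: "bij_betw h UNIV {..<4}"
    using ex_bij_betw_finite_nat[of "UNIV :: 4 set"] by (auto simp: atLeast0LessThan)
  show "product_rank 4 (perm4 :: (4 \<times> 4, 'a) mpoly) \<ge> 6"
  proof (rule perm4_product_bound)
    show "linear_form (l k (h i))" if "k < product_rank 4 (perm4 :: (4 \<times> 4, 'a) mpoly)" for k i
      using l(1) that h bij_betwE[OF h] by auto
    show "perm4 = (\<Sum>k<product_rank 4 (perm4 :: (4 \<times> 4, 'a) mpoly). \<Prod>i\<in>UNIV. l k (h i))"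
      using l(2) by (simp add: prod.reindex_bij_betw[OF h])
  qed
  obtain l :: "nat \<Rightarrow> 4 \<Rightarrow> (4 \<times> 4, 'a) mpoly"
    where "\<forall>k<tensor_rank (perm4 :: (4 \<times> 4, 'a) mpoly). \<forall>i. row_linear_form i (l k i)"
      "perm4 = (\<Sum>k<tensor_rank (perm4 :: (4 \<times> 4, 'a) mpoly). \<Prod>i\<in>UNIV. l k i)"
    using LeastI_ex[OF perm4_tensor_decomposition[where 'a = 'a]] unfolding tensor_rank_def by blast
  then show "tensor_rank (perm4 :: (4 \<times> 4, 'a) mpoly) \<ge> 6"
    by (intro perm4_product_bound[of _ l]) (auto intro: linear_form_of_row)
qed

end
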